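(* Let $\|\cdot\|$ be a norm on $\mathbb{R}^m$ with dual norm $\|\cdot\|_*$, $\Xi=\mathbb{R}^m$, $\widehat\xi_1,\dots,\widehat\xi_N\in\mathbb{R}^m$, $\widehat{\mathbb P}_N=\frac1N\sum_{i=1}^N\delta_{\widehat\xi_i}$, $\varepsilon\ge0$ and $\alpha\in[1/2,1)$. Let $\ell:\mathbb{R}^m\to\mathbb{R}$ be a convex function with $L:=\sup_{x\in\mathbb{R}^m}\|\partial\ell(x)\|_*<\infty$. Then $$\sup_{\mathbb P\in\mathbb{B}^{\alpha}_{(2),\varepsilon}(\widehat{\mathbb P}_N)}\mathbb{E}^{\mathbb P}[\ell(\xi)]=\frac1N\sum_{i=1}^N\max\Big\{\ell(\widehat\xi_i)+\beta L\varepsilon,\ \max_{\|e\|=1}\ell(\widehat\xi_i+\varepsilon e)\Big\},\qquad \beta=\frac{1-\alpha}{\alpha}.$$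
   Context: $\|\partial\ell(x)\|_*$ denotes the largest dual norm of a subgradient of $\ell$ at $x$, so $L=\sup\{\|g\|_*: x\in\mathbb{R}^m,\ g\in\partial\ell(x)\}$. For an integrable random variable $X$ and $\alpha\in[1/2,1)$, the expectile $e_\alpha(X)$ is the unique solution $x$ of $\alpha\,\mathbb{E}[(X-x)_+]=(1-\alpha)\,\mathbb{E}[(X-x)_-]$, with $a_+=\max\{a,0\}$, $a_-=\max\{-a,0\}$. The expectile-Wasserstein metric is $d_{e_\alpha}(\mathbb P_1,\mathbb P_2)=\inf_\Pi e_\alpha^{\Pi}(\|\xi_1-\xi_2\|)$, infimum over joint distributions $\Pi$ of $(\xi_1,\xi_2)$ with marginals $\mathbb P_1,\mathbb P_2$, and $\mathbb{B}^{\alpha}_{(2),\varepsilon}(\widehat{\mathbb P}_N)=\{\mathbb P\in\mathcal M(\Xi): d_{e_\alpha}(\widehat{\mathbb P}_N,\mathbb P)\le\varepsilon\}$, where $\mathcal M(\Xi)$ is the set of probability distributions supported on $\Xi$. *)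

theory Defs
  imports "HOL-Probability.Probability"
begin

definition is_norm :: "('a::real_vector \<Rightarrow> real) \<Rightarrow> bool" where
  "is_norm nrm \<longleftrightarrow>
     (\<forall>x. 0 \<le> nrm x) \<and> (\<forall>x. nrm x = 0 \<longleftrightarrow> x = 0) \<and>
     (\<forall>c x. nrm (c *\<^sub>R x) = \<bar>c\<bar> * nrm x) \<and>
     (\<forall>x y. nrm (x + y) \<le> nrm x + nrm y)"

definition dual_norm :: "('a::real_inner \<Rightarrow> real) \<Rightarrow> 'a \<Rightarrow> real" where
  "dual_norm nrm g = (SUP x\<in>{x. nrm x \<le> 1}. g \<bullet> x)"

definition subdifferential :: "('a::real_inner \<Rightarrow> real) \<Rightarrow> 'a \<Rightarrow> 'a set" where
  "subdifferential f x = {g. \<forall>y. f x + g \<bullet> (y - x) \<le> f y}"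

text \<open>
  The expectile of level \<open>\<alpha>\<close> of \<open>X\<close> under \<open>M\<close>. It is only meaningful when \<open>X\<close> is integrable
  and \<open>0 < \<alpha> < 1\<close>, in which case the defining equation has exactly one solution.
\<close>

definition expectile :: "real \<Rightarrow> 'b measure \<Rightarrow> ('b \<Rightarrow> real) \<Rightarrow> real" where
  "expectile \<alpha> M X =
     (THE x. \<alpha> * (\<integral>w. max (X w - x) 0 \<partial>M) = (1 - \<alpha>) * (\<integral>w. max (- (X w - x)) 0 \<partial>M))"

definition prob_distributions :: "'a::topological_space set \<Rightarrow> 'a measure set" where
  "prob_distributions \<Xi> = {P. prob_space P \<and> sets P = sets borel \<and> (AE x in P. x \<in> \<Xi>)}"

definition couplings ::
  "'a::topological_space measure \<Rightarrow> 'a measure \<Rightarrow> ('a \<times> 'a) measure set" where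
  "couplings P1 P2 =
     {Q. prob_space Q \<and> sets Q = sets (borel \<Otimes>\<^sub>M borel) \<and>
         distr Q borel fst = P1 \<and> distr Q borel snd = P2}"

text \<open>
  Expectiles are defined for integrable random variables only, so the infimum ranges over the
  couplings with integrable transport distance. If there is none (for a fixed finitely supported
  \<open>P1\<close>, this means that \<open>P2\<close> has no finite first moment), the infimum is \<open>\<infinity>\<close>.
\<close>

definition expectile_wasserstein ::
  "('a::real_normed_vector \<Rightarrow> real) \<Rightarrow> real \<Rightarrow> 'a measure \<Rightarrow> 'a measure \<Rightarrow> ereal" where
  "expectile_wasserstein nrm \<alpha> P1 P2 =
     (INF Q\<in>{Q \<in> couplings P1 P2. integrable Q (\<lambda>(x, y). nrm (x - y))}.
        ereal (expectile \<alpha> Q (\<lambda>(x, y). nrm (x - y))))"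

definition expectile_ball ::
  "('a::real_normed_vector \<Rightarrow> real) \<Rightarrow> real \<Rightarrow> 'a set \<Rightarrow> real \<Rightarrow> 'a measure \<Rightarrow> 'a measure set" where
  "expectile_ball nrm \<alpha> \<Xi> \<epsilon> P0 =
     {P \<in> prob_distributions \<Xi>. expectile_wasserstein nrm \<alpha> P0 P \<le> ereal \<epsilon>}"

text \<open>
  The average of the point masses at \<open>\<xi> 1, \<dots>, \<xi> N\<close> (with repetitions), as the image of the
  uniform distribution on the indices.
\<close>

definition empirical_distribution ::
  "nat \<Rightarrow> (nat \<Rightarrow> 'a::topological_space) \<Rightarrow> 'a measure" where
  "empirical_distribution N \<xi> = distr (uniform_count_measure {1..N}) borel \<xi>"

lemma emeasure_empirical_distribution:
  assumes "N \<ge> 1" and "A \<in> sets borel"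
  shows "emeasure (empirical_distribution N \<xi>) A =
    ennreal ((1 / real N) * (\<Sum>i=1..N. indicator A (\<xi> i)))"
proof -
  let ?I = "{i \<in> {1..N}. \<xi> i \<in> A}"
  have card: "(\<Sum>i=1..N. indicator A (\<xi> i) :: real) = real (card ?I)"
    by (simp add: indicator_def sum.If_cases Int_def)
  have "emeasure (empirical_distribution N \<xi>) A = emeasure (uniform_count_measure {1..N}) ?I"
    using assms(2) unfolding empirical_distribution_def
    by (subst emeasure_distr)
       (auto simp: space_uniform_count_measure measurable_def sets_uniform_count_measure
             intro!: arg_cong2[where f = emeasure])
  also have "\<dots> = ennreal (real (card ?I) / real N)"
    by (subst emeasure_uniform_count_measure) auto
  finally show ?thesis
    by (simp only: card) simp
qed

end

theory Submission
  imports Defs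
begin

text \<open>
  With \<open>\<phi>(t) = \<alpha> t\<^sub>+ - (1 - \<alpha>) t\<^sub>-\<close>, an expectile is at most \<open>\<epsilon>\<close> exactly when the expectation of
  \<open>\<phi>(X - \<epsilon>)\<close> is at most \<open>0\<close>. Up to the question whether the infimum over couplings is attained, the
  left-hand side is therefore a linear program over transport plans from the empirical distribution,
  with one linear budget constraint, and \<open>L / \<alpha>\<close> is an optimal multiplier for it.

  Upper bound. The function \<open>l\<close> is \<open>L\<close>-Lipschitz for the given norm, because it has a subgradient at
  every point. Fix \<open>x\<close> and look at the penalised gain \<open>l y - (L / \<alpha>) \<phi>(\<parallel>y - x\<parallel> - \<epsilon>)\<close> as \<open>y\<close> moves
  along a ray from \<open>x\<close>. Beyond distance \<open>\<epsilon>\<close> the penalty has slope \<open>L\<close>, so the gain does not increase;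
  up to distance \<open>\<epsilon>\<close> the penalty is affine, so the gain is convex and largest at an end of the segment.
  The end \<open>y = x\<close> gives \<open>l x + \<beta> L \<epsilon>\<close>, and the end at distance \<open>\<epsilon>\<close> gives a value on the sphere; this is
  \<open>dual_pointwise_bound\<close>. Integrating it over a coupling with expectile below \<open>\<epsilon> + \<eta>\<close>, whose expected
  penalty is at most \<open>L \<eta>\<close>, gives \<open>expectation_le_of_expectile_ball\<close>.

  Lower bound. If the sphere has the larger value at an atom, move the whole atom to the best point of
  the sphere, which neither uses nor frees any budget. Otherwise leave mass \<open>1 - \<delta>\<close> in place, which
  frees a budget proportional to \<open>(1 - \<alpha>) \<epsilon>\<close>, and spend it on sending mass \<open>\<delta>\<close> to a distance
  of order \<open>1 / \<delta>\<close> in a direction \<open>e\<close> with \<open>g \<bullet> e\<close> close to \<open>L\<close> for some subgradient \<open>g\<close>. A subgradient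
  inequality at a single point controls \<open>l\<close> arbitrarily far away, so as \<open>\<delta>\<close> tends to \<open>0\<close> the gain tends
  to at least \<open>\<beta> (g \<bullet> e) \<epsilon>\<close>. This is \<open>SUP_expectile_ball_ge\<close>; letting \<open>g \<bullet> e\<close> tend to \<open>L\<close> finishes the proof.
\<close>

section \<open>Expectiles as roots of the expected asymmetric score\<close>

definition expectile_score :: "real \<Rightarrow> real \<Rightarrow> real" where
  "expectile_score \<alpha> t = \<alpha> * max t 0 - (1 - \<alpha>) * max (- t) 0"

text \<open>
  The score has slope \<open>\<alpha>\<close> to the right of \<open>0\<close> and \<open>1 - \<alpha>\<close> to the left, and \<open>1 - \<alpha> \<le> \<alpha>\<close>. So all its
  difference quotients lie between these two slopes.
\<close>

lemma expectile_score_diff_le: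
  assumes "1 / 2 \<le> \<alpha>" "\<alpha> < 1" "s \<le> t"
  shows "expectile_score \<alpha> t - expectile_score \<alpha> s \<le> \<alpha> * (t - s)"
proof -
  have "(1 - \<alpha>) * (t - s) \<le> \<alpha> * (t - s)" "s \<le> 0 \<Longrightarrow> (1 - \<alpha>) * (-s) \<le> \<alpha> * (-s)"
    using assms by (intro mult_right_mono; simp)+
  then show ?thesis
    using assms by (auto simp: expectile_score_def max_def algebra_simps)
qed

lemma expectile_score_diff_ge:
  assumes "1 / 2 \<le> \<alpha>" "\<alpha> < 1" "s \<le> t"
  shows "(1 - \<alpha>) * (t - s) \<le> expectile_score \<alpha> t - expectile_score \<alpha> s"
proof -
  have "(1 - \<alpha>) * (t - s) \<le> \<alpha> * (t - s)" "t \<ge> 0 \<Longrightarrow> (1 - \<alpha>) * t \<le> \<alpha> * t"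
    using assms by (intro mult_right_mono; simp)+
  then show ?thesis
    using assms by (auto simp: expectile_score_def max_def algebra_simps)
qed

lemma expectile_score_mono:
  assumes "1 / 2 \<le> \<alpha>" "\<alpha> < 1" "s \<le> t"
  shows "expectile_score \<alpha> s \<le> expectile_score \<alpha> t"
proof -
  have "0 \<le> (1 - \<alpha>) * (t - s)" using assms by simp
  then show ?thesis using expectile_score_diff_ge[OF assms] by linarith
qed

lemma (in prob_space) integrable_expectile_score:
  assumes "integrable M X"
  shows "integrable M (\<lambda>w. expectile_score \<alpha> (X w - x))"
  using assms unfolding expectile_score_def by (intro Bochner_Integration.integrable_diff integrable_mult_right integrable_max) auto

lemma (in prob_space) integral_expectile_score:
  assumes "integrable M X"
  shows "(\<integral>w. expectile_score \<alpha> (X w - x) \<partial>M) =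
    \<alpha> * (\<integral>w. max (X w - x) 0 \<partial>M) - (1 - \<alpha>) * (\<integral>w. max (- (X w - x)) 0 \<partial>M)"
proof -
  have "integrable M (\<lambda>w. max (X w - x) 0)" "integrable M (\<lambda>w. max (- (X w - x)) 0)"
    using assms by (intro integrable_max; simp)+
  then show ?thesis unfolding expectile_score_def by simp
qed

text \<open>
  The slope bounds survive integration: the expected score, as a function of the threshold, is
  Lipschitz and decreases at least at the rate \<open>1 - \<alpha>\<close>. Both the existence and the uniqueness of the
  expectile come from this.
\<close>

lemma (in prob_space) expected_score_decrease:
  assumes "1 / 2 \<le> \<alpha>" "\<alpha> < 1" "integrable M X" "x \<le> y"
  shows "(1 - \<alpha>) * (y - x) \<le>
      (\<integral>w. expectile_score \<alpha> (X w - x) \<partial>M) - (\<integral>w. expectile_score \<alpha> (X w - y) \<partial>M)"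
    and "(\<integral>w. expectile_score \<alpha> (X w - x) \<partial>M) - (\<integral>w. expectile_score \<alpha> (X w - y) \<partial>M)
      \<le> \<alpha> * (y - x)"
proof -
  note int = integrable_expectile_score[OF assms(3), of \<alpha>]
  have eq: "(\<integral>w. expectile_score \<alpha> (X w - x) \<partial>M) - (\<integral>w. expectile_score \<alpha> (X w - y) \<partial>M)
    = (\<integral>w. expectile_score \<alpha> (X w - x) - expectile_score \<alpha> (X w - y) \<partial>M)"
    using int by simp
  have pt: "(1 - \<alpha>) * (y - x) \<le> expectile_score \<alpha> (X w - x) - expectile_score \<alpha> (X w - y)"
    "expectile_score \<alpha> (X w - x) - expectile_score \<alpha> (X w - y) \<le> \<alpha> * (y - x)" for w
    using expectile_score_diff_ge[OF assms(1,2), of "X w - y" "X w - x"]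
      expectile_score_diff_le[OF assms(1,2), of "X w - y" "X w - x"] assms(4) by simp_all
  show "(1 - \<alpha>) * (y - x) \<le>
      (\<integral>w. expectile_score \<alpha> (X w - x) \<partial>M) - (\<integral>w. expectile_score \<alpha> (X w - y) \<partial>M)"
    unfolding eq using pt int by (intro integral_ge_const) auto
  show "(\<integral>w. expectile_score \<alpha> (X w - x) \<partial>M) - (\<integral>w. expectile_score \<alpha> (X w - y) \<partial>M)
      \<le> \<alpha> * (y - x)"
    unfolding eq using pt int by (intro integral_le_const) auto
qed

text \<open>
  The definite description in \<open>expectile\<close> denotes a root of the expected score: the decrease at a positive
  rate forces a change of sign, and continuity and strict monotonicity give exactly one root.
\<close>

lemma (in prob_space) expected_score_at_expectile:
  assumes "1 / 2 \<le> \<alpha>" "\<alpha> < 1" "integrable M X"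
  shows "(\<integral>w. expectile_score \<alpha> (X w - expectile \<alpha> M X) \<partial>M) = 0"
proof -
  define G where "G x = (\<integral>w. expectile_score \<alpha> (X w - x) \<partial>M)" for x
  note dec = expected_score_decrease[OF assms, folded G_def]
  have strict: "G y < G x" if "x < y" for x y
  proof -
    have "0 < (1 - \<alpha>) * (y - x)" using that assms by simp
    then show ?thesis using dec(1)[of x y] that by linarith
  qed
  have "dist (G x) (G y) \<le> \<alpha> * dist x y" for x y
    using dec[of x y] dec[of y x] strict[of x y] strict[of y x]
    by (cases x y rule: linorder_cases) (auto simp: dist_real_def)
  then have "\<alpha>-lipschitz_on UNIV G"
    using assms by (auto intro!: lipschitz_onI)
  then have cont: "continuous_on {a..b} G" for a b
    using lipschitz_on_continuous_on continuous_on_subset by blast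
  \<comment> \<open>At the rate \<open>1 - \<alpha>\<close>, a displacement by \<open>R\<close> in either direction cancels the value at \<open>0\<close>.\<close>
  define R where "R = \<bar>G 0\<bar> / (1 - \<alpha>)"
  have R: "R \<ge> 0" "(1 - \<alpha>) * R = \<bar>G 0\<bar>" using assms by (auto simp: R_def)
  have "G R \<le> 0" "0 \<le> G (-R)"
    using dec(1)[of 0 R] dec(1)[of "-R" 0] R by auto
  then obtain x where x: "G x = 0"
    using IVT2'[of G R 0 "-R"] cont R by auto
  have iff: "\<alpha> * (\<integral>w. max (X w - y) 0 \<partial>M) = (1 - \<alpha>) * (\<integral>w. max (- (X w - y)) 0 \<partial>M)
    \<longleftrightarrow> G y = 0" for y
    unfolding G_def integral_expectile_score[OF assms(3)] by simp
  have "expectile \<alpha> M X = x"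
    unfolding expectile_def iff
    by (rule the_equality) (use x strict in \<open>auto, metis less_irrefl linorder_neqE_linordered_idom\<close>)
  then show ?thesis using x by (simp add: G_def)
qed

lemma (in prob_space) expectile_leI:
  assumes "1 / 2 \<le> \<alpha>" "\<alpha> < 1" "integrable M X"
    and "(\<integral>w. expectile_score \<alpha> (X w - c) \<partial>M) \<le> 0"
  shows "expectile \<alpha> M X \<le> c"
proof (rule ccontr)
  assume "\<not> ?thesis"
  then have less: "c < expectile \<alpha> M X" by simp
  then have "0 < (1 - \<alpha>) * (expectile \<alpha> M X - c)" using assms by simp
  then show False
    using expected_score_decrease(1)[OF assms(1-3), of c "expectile \<alpha> M X"] less assms(4)
      expected_score_at_expectile[OF assms(1-3)] by linarith
qed

text \<open>
  The slack \<open>\<eta>\<close> is there because the Wasserstein distance is an infimum: a distance of at most \<open>c\<close> only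
  provides couplings with an expectile below \<open>c + \<eta>\<close>.
\<close>

lemma (in prob_space) expected_score_le_of_expectile_le:
  assumes "1 / 2 \<le> \<alpha>" "\<alpha> < 1" "integrable M X" "expectile \<alpha> M X \<le> c + \<eta>" "\<eta> \<ge> 0"
  shows "(\<integral>w. expectile_score \<alpha> (X w - c) \<partial>M) \<le> \<alpha> * \<eta>"
proof -
  let ?e = "expectile \<alpha> M X"
  have "(\<integral>w. expectile_score \<alpha> (X w - c) \<partial>M) \<le> \<alpha> * max (?e - c) 0"
  proof (cases "c \<le> ?e")
    case True
    then show ?thesis using expected_score_decrease(2)[OF assms(1-3) True]
      expected_score_at_expectile[OF assms(1-3)] by simp
  next
    case False
    then have "0 \<le> (1 - \<alpha>) * (c - ?e)" using assms by simp
    then show ?thesis using expected_score_decrease(1)[OF assms(1-3), of ?e c] False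
      expected_score_at_expectile[OF assms(1-3)] by simp
  qed
  also have "\<dots> \<le> \<alpha> * \<eta>" using assms by (intro mult_left_mono) auto
  finally show ?thesis .
qed

section \<open>Norms on a Euclidean space and subgradients of convex functions\<close>

lemma
  assumes "is_norm nrm"
  shows is_norm_nonneg: "0 \<le> nrm x"
    and is_norm_eq_0_iff: "nrm x = 0 \<longleftrightarrow> x = 0"
    and is_norm_scaleR: "nrm (c *\<^sub>R x) = \<bar>c\<bar> * nrm x"
    and is_norm_triangle: "nrm (x + y) \<le> nrm x + nrm y"
  using assms by (simp_all add: is_norm_def)

lemma is_norm_minus_commute:
  assumes "is_norm nrm"
  shows "nrm (x - y) = nrm (y - x)"
  using is_norm_scaleR[OF assms, of "-1" "x - y"] by simp

lemma is_norm_unit_direction: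
  assumes "is_norm nrm" "x \<noteq> 0"
  obtains e where "nrm e = 1" "x = nrm x *\<^sub>R e"
proof
  have "nrm x > 0" using is_norm_nonneg[OF assms(1), of x] is_norm_eq_0_iff[OF assms(1), of x] assms(2) by simp
  then show "nrm (inverse (nrm x) *\<^sub>R x) = 1" "x = nrm x *\<^sub>R inverse (nrm x) *\<^sub>R x"
    by (simp_all add: is_norm_scaleR[OF assms(1)])
qed

lemma continuous_on_is_norm:
  fixes nrm :: "'a::euclidean_space \<Rightarrow> real"
  assumes "is_norm nrm"
  shows "continuous_on UNIV nrm"
proof (rule convex_on_continuous)
  show "convex_on UNIV nrm"
    unfolding convex_on_def using is_norm_triangle[OF assms] is_norm_scaleR[OF assms]
    by (metis abs_of_nonneg convex_UNIV)
qed simp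

lemma is_norm_dominates_norm:
  fixes nrm :: "'a::euclidean_space \<Rightarrow> real"
  assumes "is_norm nrm"
  obtains c where "c > 0" "\<And>x. c * norm x \<le> nrm x"
proof -
  have "compact (sphere (0::'a) 1)" "sphere (0::'a) 1 \<noteq> {}" "continuous_on (sphere 0 1) nrm"
    using continuous_on_subset[OF continuous_on_is_norm[OF assms]] by auto
  then obtain u where u: "u \<in> sphere 0 1" "\<And>y. y \<in> sphere 0 1 \<Longrightarrow> nrm u \<le> nrm y"
    using continuous_attains_inf by metis
  show ?thesis
  proof
    have "u \<noteq> 0" using u by auto
    then show "nrm u > 0" using is_norm_nonneg[OF assms, of u] is_norm_eq_0_iff[OF assms, of u] by simp
    show "nrm u * norm x \<le> nrm x" for x
    proof (cases "x = 0")
      case False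
      then have "nrm u \<le> nrm (inverse (norm x) *\<^sub>R x)" by (intro u(2)) simp
      then show ?thesis using False by (simp add: is_norm_scaleR[OF assms] field_simps)
    qed (use is_norm_nonneg[OF assms, of 0] in simp)
  qed
qed

lemma compact_unit_sphere_is_norm:
  fixes nrm :: "'a::euclidean_space \<Rightarrow> real"
  assumes "is_norm nrm"
  shows "compact {e. nrm e = 1}" "{e. nrm e = 1} \<noteq> {}"
proof -
  obtain c where c: "c > 0" "\<And>x. c * norm x \<le> nrm x" using is_norm_dominates_norm[OF assms] by metis
  have "closed {e. nrm e = 1}"
    by (intro closed_Collect_eq continuous_on_is_norm[OF assms] continuous_on_const)
  moreover have "bounded {e. nrm e = 1}"
    unfolding bounded_iff using c by (intro exI[of _ "1 / c"]) (auto simp: field_simps, metis)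
  ultimately show "compact {e. nrm e = 1}" by (simp add: compact_eq_bounded_closed)
  obtain b :: 'a where "b \<noteq> 0" using nonempty_Basis nonzero_Basis by blast
  then show "{e. nrm e = 1} \<noteq> {}" using is_norm_unit_direction[OF assms] by blast
qed

text \<open>
  The supremum in \<open>dual_norm\<close> is a supremum of reals, so its use as an upper bound rests on the
  boundedness of the unit ball, that is, on the comparison with the Euclidean norm.
\<close>

lemma inner_le_dual_norm:
  fixes nrm :: "'a::euclidean_space \<Rightarrow> real"
  assumes "is_norm nrm"
  shows "g \<bullet> x \<le> dual_norm nrm g * nrm x"
proof -
  obtain c where c: "c > 0" "\<And>x. c * norm x \<le> nrm x" using is_norm_dominates_norm[OF assms] by metis
  have "g \<bullet> y \<le> norm g * (1 / c)" if "nrm y \<le> 1" for y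
  proof -
    have "norm y \<le> 1 / c" using c(1) order_trans[OF c(2) that] by (simp add: field_simps)
    then have "norm g * norm y \<le> norm g * (1 / c)" by (intro mult_left_mono) auto
    then show ?thesis using norm_cauchy_schwarz[of g y] by linarith
  qed
  then have bdd: "bdd_above ((\<lambda>y. g \<bullet> y) ` {y. nrm y \<le> 1})" by (intro bdd_aboveI) auto
  show ?thesis
  proof (cases "x = 0")
    case False
    obtain e where e: "nrm e = 1" "x = nrm x *\<^sub>R e" using is_norm_unit_direction[OF assms False] .
    have "g \<bullet> e \<le> dual_norm nrm g"
      unfolding dual_norm_def using bdd e(1) by (intro cSUP_upper) auto
    then have "nrm x * (g \<bullet> e) \<le> nrm x * dual_norm nrm g"
      using is_norm_nonneg[OF assms] by (intro mult_left_mono)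
    moreover have "g \<bullet> x = nrm x * (g \<bullet> e)" by (subst e(2)) simp
    ultimately show ?thesis by (simp add: mult.commute)
  qed (use is_norm_eq_0_iff[OF assms, of 0] in simp)
qed

lemma dual_norm_approx:
  assumes "is_norm nrm" "s < dual_norm nrm g"
  obtains e where "nrm e \<le> 1" "s < g \<bullet> e"
proof -
  have "0 \<in> {x. nrm x \<le> 1}" using is_norm_eq_0_iff[OF assms(1), of 0] by simp
  then show ?thesis
    using that less_cSupD[of "(\<lambda>x. g \<bullet> x) ` {x. nrm x \<le> 1}" s] assms(2)
    unfolding dual_norm_def by blast
qed

text \<open>
  A hyperplane that separates the point \<open>(x, f x)\<close> from the strict epigraph cannot be vertical, since
  the epigraph projects onto the whole space; its slope is a subgradient.
\<close>

lemma subdifferential_nonempty: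
  fixes f :: "'a::euclidean_space \<Rightarrow> real"
  assumes "convex_on UNIV f"
  shows "subdifferential f x \<noteq> {}"
proof -
  let ?T = "{(y, t). f y < t}"
  have "convex ?T"
  proof (rule convexI; clarsimp)
    fix y t z s and u v :: real
    assume *: "f y < t" "f z < s" "0 \<le> u" "0 \<le> v" "u + v = 1"
    have "f (u *\<^sub>R y + v *\<^sub>R z) \<le> u * f y + v * f z"
      using assms * by (auto simp: convex_on_def)
    also have "\<dots> < u * t + v * s"
    proof (cases "u = 0")
      case False
      then show ?thesis using * by (intro add_less_le_mono mult_strict_left_mono mult_left_mono) auto
    qed (use * in auto)
    finally show "f (u *\<^sub>R y + v *\<^sub>R z) < u * t + v * s" .
  qed
  moreover have "(x, f x + 1) \<in> ?T" by simp
  then have "?T \<noteq> {}" by blast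
  moreover have "{(x, f x)} \<inter> ?T = {}" by simp
  ultimately have "\<exists>a b. a \<noteq> 0 \<and> (\<forall>p\<in>{(x, f x)}. a \<bullet> p \<le> b) \<and> (\<forall>p\<in>?T. b \<le> a \<bullet> p)"
    by (intro separating_hyperplane_sets) simp_all
  then obtain a b where ab: "a \<noteq> 0" "a \<bullet> (x, f x) \<le> b" "\<forall>p\<in>?T. b \<le> a \<bullet> p"
    by blast
  obtain p c where a: "a = (p, c)" by (cases a)
  have sep: "p \<bullet> x + c * f x \<le> p \<bullet> y + c * t" if "f y < t" for y t
    using ab(2,3) that by (force simp: a)
  have "c \<ge> 0" using sep[of x "f x + 1"] by (simp add: algebra_simps)
  moreover have "c \<noteq> 0"
  proof
    assume c: "c = 0"
    then have "p \<bullet> x \<le> p \<bullet> (x - p)" using sep[of "x - p" "f (x - p) + 1"] by simp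
    then have "p \<bullet> p \<le> 0" by (simp add: inner_diff_right)
    then have "p = 0" by (metis inner_gt_zero_iff not_le)
    then show False using ab(1) a c by (simp add: zero_prod_def)
  qed
  ultimately have c: "c > 0" by simp
  have "f x + (- (1 / c) *\<^sub>R p) \<bullet> (y - x) \<le> f y" for y
  proof (rule field_le_epsilon)
    fix e :: real assume "e > 0"
    then have "p \<bullet> x + c * f x \<le> p \<bullet> y + c * (f y + e)" by (intro sep) simp
    then show "f x + (- (1 / c) *\<^sub>R p) \<bullet> (y - x) \<le> f y + e"
      using c by (simp add: field_simps inner_diff_right)
  qed
  then show ?thesis unfolding subdifferential_def by blast
qed

text \<open>A subgradient at \<open>y\<close>, rather than at \<open>x\<close>, bounds the increase from \<open>x\<close> to \<open>y\<close> from above.\<close>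

lemma convex_lipschitz_of_dual_norm_bound:
  fixes f :: "'a::euclidean_space \<Rightarrow> real"
  assumes "is_norm nrm" "convex_on UNIV f"
    and "\<And>x g. g \<in> subdifferential f x \<Longrightarrow> dual_norm nrm g \<le> L"
  shows "f y - f x \<le> L * nrm (y - x)"
proof -
  obtain g where g: "g \<in> subdifferential f y" using subdifferential_nonempty[OF assms(2)] by blast
  then have "f y + g \<bullet> (x - y) \<le> f x" by (simp add: subdifferential_def)
  then have "f y - f x \<le> g \<bullet> (y - x)" by (simp add: inner_diff_right)
  also have "\<dots> \<le> dual_norm nrm g * nrm (y - x)" by (rule inner_le_dual_norm[OF assms(1)])
  also have "\<dots> \<le> L * nrm (y - x)"
    using assms(3)[OF g] is_norm_nonneg[OF assms(1)] by (intro mult_right_mono)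
  finally show ?thesis .
qed

lemma convex_borel_measurable:
  fixes f :: "'a::euclidean_space \<Rightarrow> real"
  assumes "convex_on UNIV f"
  shows "f \<in> borel_measurable borel"
  using convex_on_continuous[OF open_UNIV assms] by (rule borel_measurable_continuous_onI)

section \<open>The largest value on a sphere\<close>

definition sphere_max :: "('a::real_vector \<Rightarrow> real) \<Rightarrow> ('a \<Rightarrow> real) \<Rightarrow> real \<Rightarrow> 'a \<Rightarrow> real" where
  "sphere_max nrm f \<epsilon> x = (GREATEST v. v \<in> (\<lambda>e. f (x + \<epsilon> *\<^sub>R e)) ` {e. nrm e = 1})"

text \<open>The sphere of an arbitrary norm is compact and nonempty, so the greatest value exists.\<close>

lemma sphere_max_attained:
  fixes f :: "'a::euclidean_space \<Rightarrow> real"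
  assumes "is_norm nrm" "convex_on UNIV f"
  obtains e where "nrm e = 1" "sphere_max nrm f \<epsilon> x = f (x + \<epsilon> *\<^sub>R e)"
    "\<And>d. nrm d = 1 \<Longrightarrow> f (x + \<epsilon> *\<^sub>R d) \<le> sphere_max nrm f \<epsilon> x"
proof -
  have "continuous_on {e. nrm e = 1} (\<lambda>e. f (x + \<epsilon> *\<^sub>R e))"
    by (intro continuous_on_compose2[OF convex_on_continuous[OF open_UNIV assms(2)]] continuous_intros) auto
  then obtain e where e: "nrm e = 1" "\<And>d. nrm d = 1 \<Longrightarrow> f (x + \<epsilon> *\<^sub>R d) \<le> f (x + \<epsilon> *\<^sub>R e)"
    using continuous_attains_sup[OF compact_unit_sphere_is_norm[OF assms(1)]] by blast
  have "sphere_max nrm f \<epsilon> x = f (x + \<epsilon> *\<^sub>R e)"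
    unfolding sphere_max_def by (rule Greatest_equality) (use e in auto)
  then show ?thesis using that e by simp
qed

text \<open>A maximum of translates of a convex function is convex. The point of this is that it is then Borel measurable.\<close>

lemma convex_on_sphere_max:
  fixes f :: "'a::euclidean_space \<Rightarrow> real"
  assumes "is_norm nrm" "convex_on UNIV f"
  shows "convex_on UNIV (sphere_max nrm f \<epsilon>)"
  unfolding convex_on_def
proof (intro conjI ballI allI impI)
  fix x y :: 'a and u v :: real
  assume uv: "0 \<le> u" "0 \<le> v" "u + v = 1"
  obtain e where e: "nrm e = 1"
    "sphere_max nrm f \<epsilon> (u *\<^sub>R x + v *\<^sub>R y) = f ((u *\<^sub>R x + v *\<^sub>R y) + \<epsilon> *\<^sub>R e)"
    using sphere_max_attained[OF assms] by metis
  have "(u *\<^sub>R x + v *\<^sub>R y) + (u + v) *\<^sub>R (\<epsilon> *\<^sub>R e) = u *\<^sub>R (x + \<epsilon> *\<^sub>R e) + v *\<^sub>R (y + \<epsilon> *\<^sub>R e)"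
    by (simp only: scaleR_add_left scaleR_add_right add_ac)
  then have "f ((u *\<^sub>R x + v *\<^sub>R y) + \<epsilon> *\<^sub>R e) = f (u *\<^sub>R (x + \<epsilon> *\<^sub>R e) + v *\<^sub>R (y + \<epsilon> *\<^sub>R e))"
    by (simp only: uv scaleR_one)
  also have "\<dots> \<le> u * f (x + \<epsilon> *\<^sub>R e) + v * f (y + \<epsilon> *\<^sub>R e)"
    using assms(2) uv by (auto simp: convex_on_def)
  also have "\<dots> \<le> u * sphere_max nrm f \<epsilon> x + v * sphere_max nrm f \<epsilon> y"
    using uv e(1) sphere_max_attained[OF assms, of \<epsilon>] by (intro add_mono mult_left_mono) metis+
  finally show "sphere_max nrm f \<epsilon> (u *\<^sub>R x + v *\<^sub>R y) \<le> u * sphere_max nrm f \<epsilon> x + v * sphere_max nrm f \<epsilon> y"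
    by (simp only: e(2))
qed simp

section \<open>The upper bound\<close>

text \<open>
  Dual feasibility of the multiplier \<open>L / \<alpha>\<close>: beyond the sphere the Lipschitz bound is used from the point
  where the ray from \<open>x\<close> to \<open>y\<close> meets the sphere, and inside it convexity of \<open>l\<close> along that ray.
\<close>

lemma dual_pointwise_bound:
  fixes l :: "'a::euclidean_space \<Rightarrow> real"
  assumes nrm: "is_norm nrm" and l: "convex_on UNIV l"
    and lip: "\<And>x y. l y - l x \<le> L * nrm (y - x)"
    and \<epsilon>: "\<epsilon> \<ge> 0" and \<alpha>: "1 / 2 \<le> \<alpha>" "\<alpha> < 1" and \<beta>: "\<beta> = (1 - \<alpha>) / \<alpha>"
  shows "l y \<le> max (l x + \<beta> * L * \<epsilon>) (sphere_max nrm l \<epsilon> x)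
    + L / \<alpha> * expectile_score \<alpha> (nrm (x - y) - \<epsilon>)"
proof -
  define F where "F = max (l x + \<beta> * L * \<epsilon>) (sphere_max nrm l \<epsilon> x)"
  define r where "r = nrm (y - x)"
  have r: "r \<ge> 0" "nrm (x - y) = r"
    unfolding r_def using is_norm_nonneg[OF nrm] is_norm_minus_commute[OF nrm] by auto
  have score: "L / \<alpha> * expectile_score \<alpha> (r - \<epsilon>) =
    (if r \<ge> \<epsilon> then L * (r - \<epsilon>) else - (\<beta> * L * (\<epsilon> - r)))"
    using \<alpha> by (simp add: expectile_score_def \<beta> field_simps)
  have "l y \<le> F + (if r \<ge> \<epsilon> then L * (r - \<epsilon>) else - (\<beta> * L * (\<epsilon> - r)))"
  proof (cases "y = x")
    case True
    then have "r = 0" using is_norm_eq_0_iff[OF nrm, of 0] by (simp add: r_def)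
    then show ?thesis using True \<epsilon> by (auto simp: F_def)
  next
    case False
    then obtain e where e: "nrm e = 1" "y - x = r *\<^sub>R e"
      using is_norm_unit_direction[OF nrm, of "y - x"] unfolding r_def by auto
    have F: "l (x + \<epsilon> *\<^sub>R e) \<le> F" "l x + \<beta> * L * \<epsilon> \<le> F"
      using sphere_max_attained[OF nrm l, of \<epsilon> x] e(1) unfolding F_def by (metis max.coboundedI2, simp)
    have y: "y = x + r *\<^sub>R e" using e(2) by (simp add: algebra_simps)
    show ?thesis
    proof (cases "r \<ge> \<epsilon>")
      case True
      have "y - (x + \<epsilon> *\<^sub>R e) = (r - \<epsilon>) *\<^sub>R e" by (simp add: y scaleR_diff_left)
      then have "nrm (y - (x + \<epsilon> *\<^sub>R e)) = r - \<epsilon>"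
        using True e(1) by (simp add: is_norm_scaleR[OF nrm])
      then show ?thesis using lip[where y = y and x = "x + \<epsilon> *\<^sub>R e"] F True by simp
    next
      case False
      define t where "t = r / \<epsilon>"
      have t: "0 \<le> t" "t \<le> 1" "r = t * \<epsilon>" using False r by (auto simp: t_def field_simps)
      have "y = (1 - t) *\<^sub>R x + t *\<^sub>R (x + \<epsilon> *\<^sub>R e)"
        by (simp add: y t(3) algebra_simps)
      then have "l y \<le> (1 - t) * l x + t * l (x + \<epsilon> *\<^sub>R e)"
        using l t by (auto simp: convex_on_def)
      also have "\<dots> \<le> (1 - t) * (F - \<beta> * L * \<epsilon>) + t * F"
        using t F by (intro add_mono mult_left_mono) auto
      finally show ?thesis using False by (simp add: t(3) algebra_simps)
    qed
  qed
  then show ?thesis by (simp only: score[symmetric] F_def r(2))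
qed

lemma integral_empirical_distribution:
  assumes "N \<ge> 1" "f \<in> borel_measurable borel"
  shows "(\<integral>x. f x \<partial>empirical_distribution N \<xi>) = (1 / real N) * (\<Sum>i=1..N. f (\<xi> i))"
    and "integrable (empirical_distribution N \<xi>) (f :: _ \<Rightarrow> real)"
proof -
  have \<xi>: "\<xi> \<in> measurable (uniform_count_measure {1..N}) borel"
    by (auto simp: measurable_def sets_uniform_count_measure space_uniform_count_measure)
  have "integrable (uniform_count_measure {1..N}) (\<lambda>i. f (\<xi> i))"
    unfolding uniform_count_measure_def by (intro integrable_point_measure_finite) auto
  then show "integrable (empirical_distribution N \<xi>) f"
    unfolding empirical_distribution_def using \<xi> assms by (simp add: integrable_distr_eq)
  show "(\<integral>x. f x \<partial>empirical_distribution N \<xi>) = (1 / real N) * (\<Sum>i=1..N. f (\<xi> i))"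
    unfolding empirical_distribution_def using \<xi> assms
    by (simp add: integral_distr integral_uniform_count_measure)
qed

text \<open>
  Weak duality. The Lipschitz bound also makes \<open>l\<close> integrable under every distribution in the ball, which
  matters because the integral of a function that is not integrable is \<open>0\<close> by convention.
\<close>

lemma expectation_le_of_expectile_ball:
  fixes l F :: "'a::euclidean_space \<Rightarrow> real"
  assumes nrm: "is_norm nrm" and N: "N \<ge> 1" and \<alpha>: "1 / 2 \<le> \<alpha>" "\<alpha> < 1"
    and L: "L \<ge> 0" and lip: "\<And>x y. l y - l x \<le> L * nrm (y - x)"
    and meas: "l \<in> borel_measurable borel" "F \<in> borel_measurable borel"
    and bound: "\<And>x y. l y \<le> F x + L / \<alpha> * expectile_score \<alpha> (nrm (x - y) - \<epsilon>)"
    and P: "P \<in> expectile_ball nrm \<alpha> UNIV \<epsilon> (empirical_distribution N \<xi>)"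
  shows "(\<integral>x. l x \<partial>P) \<le> (1 / real N) * (\<Sum>i=1..N. F (\<xi> i))"
proof -
  let ?E = "empirical_distribution N \<xi>"
  have "(\<integral>x. l x \<partial>P) \<le> (1 / real N) * (\<Sum>i=1..N. F (\<xi> i)) + L * \<eta>" if \<eta>: "\<eta> > 0" for \<eta>
  proof -
    have "expectile_wasserstein nrm \<alpha> ?E P < ereal (\<epsilon> + \<eta>)"
      using P \<eta> by (auto simp: expectile_ball_def intro: le_less_trans)
    then obtain Q where Q: "Q \<in> couplings ?E P" "integrable Q (\<lambda>(x, y). nrm (x - y))"
      "expectile \<alpha> Q (\<lambda>(x, y). nrm (x - y)) < \<epsilon> + \<eta>"
      unfolding expectile_wasserstein_def INF_less_iff by auto
    interpret Q: prob_space Q using Q(1) by (simp add: couplings_def)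
    have sets: "sets Q = sets (borel \<Otimes>\<^sub>M borel)" and marg: "distr Q borel fst = ?E" "distr Q borel snd = P"
      using Q(1) by (auto simp: couplings_def)
    have ms[measurable]: "fst \<in> measurable Q borel" "snd \<in> measurable Q borel"
      by (simp_all add: measurable_cong_sets[OF sets refl])
    define X where "X = (\<lambda>(x, y). nrm (x - y) :: real)"
    have X: "integrable Q X" using Q(2) by (simp add: X_def)
    have iF: "integrable Q (\<lambda>p. F (fst p))" "integrable Q (\<lambda>p. l (fst p))"
      using integral_empirical_distribution(2)[OF N meas(2), of \<xi>] integral_empirical_distribution(2)[OF N meas(1), of \<xi>]
      unfolding marg(1)[symmetric] using meas by (simp_all add: integrable_distr_eq)
    have il: "integrable Q (\<lambda>p. l (snd p))"
    proof (rule Bochner_Integration.integrable_bound)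
      show "integrable Q (\<lambda>p. \<bar>l (fst p)\<bar> + L * X p)" using iF X by auto
      show "(\<lambda>p. l (snd p)) \<in> borel_measurable Q" using meas ms by measurable
      have "\<bar>l y - l x\<bar> \<le> L * nrm (x - y)" for x y
        using lip[where x = x and y = y] lip[where x = y and y = x] is_norm_minus_commute[OF nrm, of x y] by auto
      then have "\<bar>l y\<bar> \<le> \<bar>l x\<bar> + L * nrm (x - y)" for x y by (smt (verit))
      then show "AE p in Q. norm (l (snd p)) \<le> norm (\<bar>l (fst p)\<bar> + L * X p)"
        by (intro AE_I2) (auto simp: X_def intro: order_trans[OF _ abs_ge_self])
    qed
    have iS: "integrable Q (\<lambda>p. expectile_score \<alpha> (X p - \<epsilon>))"
      by (rule Q.integrable_expectile_score[OF X])
    have "(\<integral>x. l x \<partial>P) = (\<integral>p. l (snd p) \<partial>Q)"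
      unfolding marg(2)[symmetric] using meas ms by (simp add: integral_distr)
    also have "\<dots> \<le> (\<integral>p. F (fst p) + L / \<alpha> * expectile_score \<alpha> (X p - \<epsilon>) \<partial>Q)"
      using bound iF iS il by (intro integral_mono) (auto simp: X_def)
    also have "\<dots> = (\<integral>p. F (fst p) \<partial>Q) + L / \<alpha> * (\<integral>p. expectile_score \<alpha> (X p - \<epsilon>) \<partial>Q)"
      using iF iS by simp
    also have "(\<integral>p. F (fst p) \<partial>Q) = (\<integral>x. F x \<partial>?E)"
      unfolding marg(1)[symmetric] using meas ms by (simp add: integral_distr)
    also have "\<dots> = (1 / real N) * (\<Sum>i=1..N. F (\<xi> i))"
      by (rule integral_empirical_distribution(1)[OF N meas(2)])
    also have "L / \<alpha> * (\<integral>p. expectile_score \<alpha> (X p - \<epsilon>) \<partial>Q) \<le> L / \<alpha> * (\<alpha> * \<eta>)"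
      using Q.expected_score_le_of_expectile_le[OF \<alpha> X, of \<epsilon> \<eta>] Q(3) \<eta> L \<alpha>
      by (intro mult_left_mono) (auto simp: X_def)
    finally show ?thesis using \<alpha> by simp
  qed
  then have "(\<integral>x. l x \<partial>P) \<le> (1 / real N) * (\<Sum>i=1..N. F (\<xi> i)) + e" if "e > 0" for e
    using that L by (cases "L = 0") (force, metis (no_types) divide_pos_pos less_le nonzero_mult_div_cancel_left times_divide_eq_right)
  then show ?thesis by (rule field_le_epsilon)
qed

section \<open>The lower bound\<close>

lemma expectation_pair_uniform_bernoulli:
  fixes f :: "nat \<times> bool \<Rightarrow> real"
  assumes "N \<ge> 1" "0 \<le> \<delta>" "\<delta> \<le> 1"
  shows "measure_pmf.expectation (pair_pmf (pmf_of_set {1..N}) (bernoulli_pmf \<delta>)) f =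
    (1 / real N) * (\<Sum>i=1..N. (1 - \<delta>) * f (i, False) + \<delta> * f (i, True))"
proof -
  have "measure_pmf.expectation (pair_pmf (pmf_of_set {1..N}) (bernoulli_pmf \<delta>)) f =
    (\<Sum>a\<in>{1..N} \<times> UNIV. f a * pmf (pair_pmf (pmf_of_set {1..N}) (bernoulli_pmf \<delta>)) a)"
    using assms by (intro integral_measure_pmf_real) auto
  also have "\<dots> = (\<Sum>i=1..N. \<Sum>b\<in>UNIV. f (i, b) * pmf (pair_pmf (pmf_of_set {1..N}) (bernoulli_pmf \<delta>)) (i, b))"
    by (simp add: sum.cartesian_product)
  also have "\<dots> = (\<Sum>i=1..N. (1 / real N) * ((1 - \<delta>) * f (i, False) + \<delta> * f (i, True)))"
    using assms by (intro sum.cong) (auto simp: UNIV_bool pmf_pair field_simps)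
  finally show ?thesis by (simp only: sum_distrib_left)
qed

text \<open>
  The feasible plans for the lower bound: each atom \<open>\<xi> i\<close> sends the share \<open>1 - \<delta>\<close> of its mass to \<open>a i\<close> and
  the share \<open>\<delta>\<close> to \<open>b i\<close>. The coupling is the image of a uniform index and an independent coin. It suffices
  for the lower bound that the budget is respected atom by atom.
\<close>

lemma two_point_splitting_in_ball:
  fixes nrm :: "'a::euclidean_space \<Rightarrow> real" and l :: "'a \<Rightarrow> real"
  assumes nrm: "is_norm nrm" and N: "N \<ge> 1" and \<alpha>: "1 / 2 \<le> \<alpha>" "\<alpha> < 1"
    and \<delta>: "0 \<le> \<delta>" "\<delta> \<le> 1" and l: "l \<in> borel_measurable borel"
    and budget: "\<And>i. i \<in> {1..N} \<Longrightarrow> (1 - \<delta>) * expectile_score \<alpha> (nrm (\<xi> i - a i) - \<epsilon>)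
      + \<delta> * expectile_score \<alpha> (nrm (\<xi> i - b i) - \<epsilon>) \<le> 0"
  obtains P where "P \<in> expectile_ball nrm \<alpha> UNIV \<epsilon> (empirical_distribution N \<xi>)"
    "(\<integral>x. l x \<partial>P) = (1 / real N) * (\<Sum>i=1..N. (1 - \<delta>) * l (a i) + \<delta> * l (b i))"
proof -
  let ?p = "pair_pmf (pmf_of_set {1..N}) (bernoulli_pmf \<delta>)"
  define h where "h = (\<lambda>(i, c). if c then b i else a i)"
  define k where "k = (\<lambda>q. (\<xi> (fst q), h q))"
  define Q where "Q = distr (measure_pmf ?p) (borel \<Otimes>\<^sub>M borel) k"
  define P where "P = distr (measure_pmf ?p) borel h"
  define X where "X = (\<lambda>(x, y). nrm (x - y) :: real)"
  note expect = expectation_pair_uniform_bernoulli[OF N \<delta>]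
  have finite: "finite (set_pmf ?p)" using N by simp
  have kmeas: "k \<in> measurable (measure_pmf ?p) (borel \<Otimes>\<^sub>M borel)"
    by (simp add: space_pair_measure)
  interpret Q: prob_space Q unfolding Q_def by (rule measure_pmf.prob_space_distr[OF kmeas])
  have nrm_meas: "nrm \<in> borel_measurable borel"
    by (rule borel_measurable_continuous_onI[OF continuous_on_is_norm[OF nrm]])
  have Xmeas: "X \<in> borel_measurable (borel \<Otimes>\<^sub>M borel)"
    unfolding X_def using nrm_meas by measurable
  have X: "integrable Q X" unfolding Q_def
    using kmeas Xmeas finite by (simp add: integrable_distr_eq integrable_measure_pmf_finite)
  have "distr Q borel fst = empirical_distribution N \<xi>"
  proof (rule measure_eqI)
    show "sets (distr Q borel fst) = sets (empirical_distribution N \<xi>)"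
      by (simp add: empirical_distribution_def)
    fix A assume "A \<in> sets (distr Q borel fst)"
    then have A: "A \<in> sets borel" by simp
    have "distr Q borel fst = distr (measure_pmf ?p) borel (\<lambda>q. \<xi> (fst q))"
      unfolding Q_def by (subst distr_distr[OF _ kmeas]) (auto simp: k_def comp_def)
    also have "\<dots> = distr (measure_pmf (map_pmf fst ?p)) borel \<xi>"
      by (simp add: map_pmf_rep_eq distr_distr comp_def)
    finally have "emeasure (distr Q borel fst) A = emeasure (measure_pmf (pmf_of_set {1..N})) (\<xi> -` A)"
      using A by (simp add: map_fst_pair_pmf emeasure_distr)
    also have "\<dots> = ennreal ((1 / real N) * (\<Sum>i=1..N. indicator A (\<xi> i)))"
    proof -
      have "(\<Sum>i=1..N. indicator A (\<xi> i) :: real) = real (card ({1..N} \<inter> \<xi> -` A))"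
        by (simp add: indicator_def sum.If_cases Int_def vimage_def)
      then show ?thesis using N by (simp add: emeasure_pmf_of_set)
    qed
    finally show "emeasure (distr Q borel fst) A = emeasure (empirical_distribution N \<xi>) A"
      by (simp only: emeasure_empirical_distribution[OF N A])
  qed
  moreover have "distr Q borel snd = P"
    unfolding Q_def P_def by (subst distr_distr[OF _ kmeas]) (auto simp: k_def comp_def)
  moreover have "sets Q = sets (borel \<Otimes>\<^sub>M borel)" by (simp add: Q_def)
  ultimately have Q: "Q \<in> couplings (empirical_distribution N \<xi>) P"
    using Q.prob_space_axioms by (simp add: couplings_def)
  have "(\<integral>w. expectile_score \<alpha> (X w - \<epsilon>) \<partial>Q) =
    measure_pmf.expectation ?p (\<lambda>q. expectile_score \<alpha> (X (k q) - \<epsilon>))"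
    unfolding Q_def using kmeas Xmeas
    by (intro integral_distr) (auto simp: expectile_score_def)
  also have "\<dots> \<le> 0"
    unfolding expect using budget
    by (intro mult_nonneg_nonpos sum_nonpos) (simp_all add: X_def k_def h_def)
  finally have "expectile \<alpha> Q X \<le> \<epsilon>" by (rule Q.expectile_leI[OF \<alpha> X])
  moreover have "expectile_wasserstein nrm \<alpha> (empirical_distribution N \<xi>) P \<le> ereal (expectile \<alpha> Q X)"
    unfolding expectile_wasserstein_def X_def by (rule INF_lower) (use Q X in \<open>simp add: X_def\<close>)
  ultimately have "expectile_wasserstein nrm \<alpha> (empirical_distribution N \<xi>) P \<le> ereal \<epsilon>"
    by (meson ereal_less_eq(3) order_trans)
  moreover have "P \<in> prob_distributions UNIV"
    unfolding prob_distributions_def P_def by (auto intro!: measure_pmf.prob_space_distr)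
  ultimately have "P \<in> expectile_ball nrm \<alpha> UNIV \<epsilon> (empirical_distribution N \<xi>)"
    by (simp add: expectile_ball_def)
  moreover have "(\<integral>x. l x \<partial>P) = (1 / real N) * (\<Sum>i=1..N. (1 - \<delta>) * l (a i) + \<delta> * l (b i))"
  proof -
    have "(\<integral>x. l x \<partial>P) = measure_pmf.expectation ?p (\<lambda>q. l (h q))"
      unfolding P_def using l by (simp add: integral_distr)
    then show ?thesis unfolding expect by (simp add: h_def)
  qed
  ultimately show ?thesis using that by blast
qed

text \<open>
  The set \<open>K\<close> contains the indices whose atom is split; the other atoms move to their best point on the
  sphere.
\<close>

lemma SUP_expectile_ball_ge:
  fixes nrm :: "'a::euclidean_space \<Rightarrow> real" and l :: "'a \<Rightarrow> real"
  assumes nrm: "is_norm nrm" and l: "convex_on UNIV l" and N: "N \<ge> 1" and \<epsilon>: "\<epsilon> \<ge> 0"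
    and \<alpha>: "1 / 2 \<le> \<alpha>" "\<alpha> < 1" and \<beta>: "\<beta> = (1 - \<alpha>) / \<alpha>"
    and g: "g \<in> subdifferential l z" and e: "nrm e \<le> 1"
  shows "ereal ((1 / real N) * (\<Sum>i=1..N. if i \<in> K then l (\<xi> i) + \<beta> * (g \<bullet> e) * \<epsilon>
        else sphere_max nrm l \<epsilon> (\<xi> i)))
    \<le> (SUP P\<in>expectile_ball nrm \<alpha> UNIV \<epsilon> (empirical_distribution N \<xi>). ereal (\<integral>x. l x \<partial>P))"
    (is "_ \<le> ?S")
proof -
  have "\<exists>e. nrm e = 1 \<and> sphere_max nrm l \<epsilon> (\<xi> i) = l (\<xi> i + \<epsilon> *\<^sub>R e)" for i
    using sphere_max_attained[OF nrm l, of \<epsilon> "\<xi> i"] by blast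
  then obtain d where d: "\<And>i. nrm (d i) = 1" "\<And>i. sphere_max nrm l \<epsilon> (\<xi> i) = l (\<xi> i + \<epsilon> *\<^sub>R d i)"
    by metis
  \<comment> \<open>The value of the plan after \<open>l\<close> at the far point is replaced by its subgradient minorant: it is
    polynomial in \<open>\<delta>\<close>, and its value at \<open>0\<close> is the claimed bound.\<close>
  define W where "W \<delta> = (1 / real N) * (\<Sum>i=1..N. if i \<in> K
      then (1 - \<delta>) * l (\<xi> i) + \<delta> * (l z + g \<bullet> (\<xi> i - z)) + (\<delta> * \<epsilon> + \<beta> * \<epsilon> * (1 - \<delta>)) * (g \<bullet> e)
      else sphere_max nrm l \<epsilon> (\<xi> i))" for \<delta>
  have W: "ereal (W \<delta>) \<le> ?S" if \<delta>: "0 < \<delta>" "\<delta> < 1" for \<delta>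
  proof -
    \<comment> \<open>The largest distance at which the mass \<open>\<delta>\<close> costs no more than the mass \<open>1 - \<delta>\<close> in place frees.\<close>
    define r where "r = \<epsilon> + \<beta> * \<epsilon> * (1 - \<delta>) / \<delta>"
    have \<beta>0: "\<beta> \<ge> 0" using \<alpha> \<beta> by simp
    have r: "r \<ge> \<epsilon>" "\<delta> * r = \<delta> * \<epsilon> + \<beta> * \<epsilon> * (1 - \<delta>)"
      using \<beta>0 \<epsilon> \<delta> by (simp_all add: r_def distrib_left)
    define a where "a i = (if i \<in> K then \<xi> i else \<xi> i + \<epsilon> *\<^sub>R d i)" for i
    define b where "b i = (if i \<in> K then \<xi> i + r *\<^sub>R e else \<xi> i + \<epsilon> *\<^sub>R d i)" for i
    have neg: "nrm (- x) = nrm x" for x using is_norm_scaleR[OF nrm, of "-1" x] by simp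
    have "(1 - \<delta>) * expectile_score \<alpha> (nrm (\<xi> i - a i) - \<epsilon>)
      + \<delta> * expectile_score \<alpha> (nrm (\<xi> i - b i) - \<epsilon>) \<le> 0" for i
    proof (cases "i \<in> K")
      case True
      have "nrm (r *\<^sub>R e) \<le> r" using r \<epsilon> e by (simp add: is_norm_scaleR[OF nrm] mult_left_le)
      then have "expectile_score \<alpha> (nrm (\<xi> i - b i) - \<epsilon>) \<le> expectile_score \<alpha> (r - \<epsilon>)"
        using True by (intro expectile_score_mono \<alpha>) (simp add: b_def neg)
      also have "\<dots> = \<alpha> * (r - \<epsilon>)" using r by (simp add: expectile_score_def)
      finally have "\<delta> * expectile_score \<alpha> (nrm (\<xi> i - b i) - \<epsilon>) \<le> \<delta> * (\<alpha> * (r - \<epsilon>))"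
        using \<delta> by (intro mult_left_mono) auto
      also have "\<dots> = \<alpha> * (\<delta> * r - \<delta> * \<epsilon>)" by (simp add: algebra_simps)
      also have "\<dots> = (1 - \<delta>) * ((1 - \<alpha>) * \<epsilon>)" using \<alpha> by (simp add: r(2) \<beta>)
      finally show ?thesis
        using True \<epsilon> is_norm_eq_0_iff[OF nrm, of 0] by (simp add: a_def expectile_score_def)
    next
      case False
      then show ?thesis
        using \<epsilon> d(1) by (simp add: a_def b_def neg is_norm_scaleR[OF nrm] expectile_score_def)
    qed
    then obtain P where P: "P \<in> expectile_ball nrm \<alpha> UNIV \<epsilon> (empirical_distribution N \<xi>)"
      "(\<integral>x. l x \<partial>P) = (1 / real N) * (\<Sum>i=1..N. (1 - \<delta>) * l (a i) + \<delta> * l (b i))"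
      using two_point_splitting_in_ball[OF nrm N \<alpha>, of \<delta> l \<xi> a \<epsilon> b] \<delta> convex_borel_measurable[OF l] by auto
    have "W \<delta> \<le> (\<integral>x. l x \<partial>P)"
      unfolding W_def P(2)
    proof (intro mult_left_mono sum_mono)
      fix i
      have "l z + g \<bullet> (\<xi> i + r *\<^sub>R e - z) \<le> l (\<xi> i + r *\<^sub>R e)"
        using g by (simp add: subdifferential_def)
      then have "\<delta> * (l z + g \<bullet> (\<xi> i - z) + r * (g \<bullet> e)) \<le> \<delta> * l (\<xi> i + r *\<^sub>R e)"
        using \<delta> by (intro mult_left_mono) (auto simp: inner_add_right inner_diff_right)
      then have "\<delta> * (l z + g \<bullet> (\<xi> i - z)) + (\<delta> * r) * (g \<bullet> e) \<le> \<delta> * l (\<xi> i + r *\<^sub>R e)"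
        by (simp add: algebra_simps)
      then show "(if i \<in> K then (1 - \<delta>) * l (\<xi> i) + \<delta> * (l z + g \<bullet> (\<xi> i - z))
            + (\<delta> * \<epsilon> + \<beta> * \<epsilon> * (1 - \<delta>)) * (g \<bullet> e) else sphere_max nrm l \<epsilon> (\<xi> i))
          \<le> (1 - \<delta>) * l (a i) + \<delta> * l (b i)"
        unfolding r(2) by (simp add: a_def b_def d(2) algebra_simps)
    qed simp
    then show ?thesis using SUP_upper[OF P(1), of "\<lambda>P. ereal (\<integral>x. l x \<partial>P)"]
      by (meson ereal_less_eq(3) order_trans)
  qed
  have "continuous_on UNIV W" unfolding W_def
  proof (intro continuous_intros)
    fix i
    show "continuous_on UNIV (\<lambda>\<delta>. if i \<in> K then (1 - \<delta>) * l (\<xi> i) + \<delta> * (l z + g \<bullet> (\<xi> i - z))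
            + (\<delta> * \<epsilon> + \<beta> * \<epsilon> * (1 - \<delta>)) * (g \<bullet> e) else sphere_max nrm l \<epsilon> (\<xi> i))"
      by (cases "i \<in> K") (auto intro!: continuous_intros)
  qed
  then have "(W \<longlongrightarrow> W 0) (at_right 0)"
    by (meson UNIV_I continuous_on_def tendsto_within_subset subset_UNIV)
  then have "((\<lambda>\<delta>. ereal (W \<delta>)) \<longlongrightarrow> ereal (W 0)) (at_right 0)" by (rule tendsto_ereal)
  moreover have "eventually (\<lambda>\<delta>. ereal (W \<delta>) \<le> ?S) (at_right 0)"
    using W unfolding eventually_at_right_field by (intro exI[of _ 1]) auto
  ultimately have "ereal (W 0) \<le> ?S" by (rule tendsto_upperbound) simp
  then show ?thesis by (simp add: W_def mult_ac cong: if_cong)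
qed

section \<open>The worst-case expectation over the ball\<close>

theorem theorem5:
  fixes nrm :: "real ^ 'm \<Rightarrow> real"
    and \<xi> :: "nat \<Rightarrow> real ^ 'm"
    and l :: "real ^ 'm \<Rightarrow> real"
    and N :: nat and \<epsilon> \<alpha> \<beta> L :: real
  assumes "is_norm nrm"
    and "N \<ge> 1"
    and "\<epsilon> \<ge> 0"
    and "1 / 2 \<le> \<alpha>" and "\<alpha> < 1"
    and "convex_on UNIV l"
    and "ereal L = (SUP g\<in>(\<Union>x. subdifferential l x). ereal (dual_norm nrm g))"
    and "\<beta> = (1 - \<alpha>) / \<alpha>"
  shows "(SUP P\<in>expectile_ball nrm \<alpha> UNIV \<epsilon> (empirical_distribution N \<xi>).
             ereal (\<integral>x. l x \<partial>P)) =
         ereal ((1 / real N) *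
           (\<Sum>i=1..N. max (l (\<xi> i) + \<beta> * L * \<epsilon>)
                         (GREATEST v. v \<in> (\<lambda>e. l (\<xi> i + \<epsilon> *\<^sub>R e)) ` {e. nrm e = 1})))"
proof -
  note nrm = assms(1) and N = assms(2) and \<epsilon> = assms(3) and \<alpha> = assms(4,5) and l = assms(6)
    and L = assms(7) and \<beta> = assms(8)
  let ?S = "SUP P\<in>expectile_ball nrm \<alpha> UNIV \<epsilon> (empirical_distribution N \<xi>). ereal (\<integral>x. l x \<partial>P)"
  define F where "F x = max (l x + \<beta> * L * \<epsilon>) (sphere_max nrm l \<epsilon> x)" for x
  have dual_le: "dual_norm nrm g \<le> L" if "g \<in> subdifferential l x" for g x
  proof -
    have "ereal (dual_norm nrm g) \<le> ereal L" unfolding L using that by (intro SUP_upper) auto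
    then show ?thesis by simp
  qed
  have lip: "l y - l x \<le> L * nrm (y - x)" for x y
    by (rule convex_lipschitz_of_dual_norm_bound[OF nrm l]) (rule dual_le)
  have "L \<ge> 0"
  proof -
    obtain e where e: "nrm e = 1" using compact_unit_sphere_is_norm[OF nrm] by auto
    then have "nrm (- e) = 1" using is_norm_scaleR[OF nrm, of "-1" e] by simp
    then show ?thesis using lip[where y = 0 and x = e] lip[where y = e and x = 0] e by simp
  qed
  have meas: "l \<in> borel_measurable borel" "F \<in> borel_measurable borel"
    using convex_borel_measurable[OF l] convex_borel_measurable[OF convex_on_sphere_max[OF nrm l]]
    unfolding F_def by measurable
  have upper: "?S \<le> ereal ((1 / real N) * (\<Sum>i=1..N. F (\<xi> i)))"
  proof (rule SUP_least)
    fix P assume P: "P \<in> expectile_ball nrm \<alpha> UNIV \<epsilon> (empirical_distribution N \<xi>)"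
    show "ereal (\<integral>x. l x \<partial>P) \<le> ereal ((1 / real N) * (\<Sum>i=1..N. F (\<xi> i)))"
      using expectation_le_of_expectile_ball[OF nrm N \<alpha> \<open>L \<ge> 0\<close> lip meas _ P]
        dual_pointwise_bound[OF nrm l lip \<epsilon> \<alpha> \<beta>] by (simp add: F_def)
  qed
  \<comment> \<open>The atoms at which the first term of the maximum wins are the ones to split.\<close>
  define K where "K = {i. sphere_max nrm l \<epsilon> (\<xi> i) \<le> l (\<xi> i) + \<beta> * L * \<epsilon>}"
  define V where "V s = (1 / real N) * (\<Sum>i=1..N. if i \<in> K then l (\<xi> i) + \<beta> * s * \<epsilon>
        else sphere_max nrm l \<epsilon> (\<xi> i))" for s
  have V: "ereal (V s) \<le> ?S" if "s < L" for s
  proof -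
    have "ereal s < (SUP g\<in>(\<Union>x. subdifferential l x). ereal (dual_norm nrm g))"
      using that by (simp flip: L)
    then obtain g z where g: "g \<in> subdifferential l z" "s < dual_norm nrm g"
      unfolding less_SUP_iff by auto
    obtain e where e: "nrm e \<le> 1" "s < g \<bullet> e" using dual_norm_approx[OF nrm g(2)] .
    have "\<beta> * s * \<epsilon> \<le> \<beta> * (g \<bullet> e) * \<epsilon>"
      using e \<epsilon> \<alpha> by (intro mult_right_mono mult_left_mono) (auto simp: \<beta>)
    then have "V s \<le> V (g \<bullet> e)"
      unfolding V_def by (intro mult_left_mono sum_mono) auto
    then show ?thesis
      using SUP_expectile_ball_ge[OF nrm l N \<epsilon> \<alpha> \<beta> g(1) e(1), of K \<xi>] unfolding V_def
      by (meson ereal_less_eq(3) order_trans)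
  qed
  have "continuous_on UNIV V" unfolding V_def
  proof (intro continuous_intros)
    fix i
    show "continuous_on UNIV (\<lambda>s. if i \<in> K then l (\<xi> i) + \<beta> * s * \<epsilon> else sphere_max nrm l \<epsilon> (\<xi> i))"
      by (cases "i \<in> K") (auto intro!: continuous_intros)
  qed
  then have "(V \<longlongrightarrow> V L) (at_left L)"
    by (meson UNIV_I continuous_on_def tendsto_within_subset subset_UNIV)
  then have "((\<lambda>s. ereal (V s)) \<longlongrightarrow> ereal (V L)) (at_left L)" by (rule tendsto_ereal)
  moreover have "eventually (\<lambda>s. ereal (V s) \<le> ?S) (at_left L)"
    using V unfolding eventually_at_left_field by (intro exI[of _ "L - 1"]) auto
  ultimately have "ereal (V L) \<le> ?S" by (rule tendsto_upperbound) simp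
  moreover have "V L = (1 / real N) * (\<Sum>i=1..N. F (\<xi> i))"
    unfolding V_def F_def K_def by (intro arg_cong2[where f = "(*)"] sum.cong) auto
  ultimately have "?S = ereal ((1 / real N) * (\<Sum>i=1..N. F (\<xi> i)))"
    using upper by (simp add: order_antisym)
  then show ?thesis unfolding F_def sphere_max_def .
qed

end
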